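(* Let $(X,\mathscr B,m)$ be a Polish probability space, let $(T,\mathscr A,p)$ be a probability space and let $(\Omega,\mathscr F,\mathbb P)=(T^{\mathbb N},\mathscr A^{\mathbb N},p^{\mathbb N})$ be its infinite product. Let $f:T\times X\to X$ be a measurable map, let $F:\Omega\times X\to\Omega\times X$, $F(\omega,x)=(\sigma(\omega),f_{\omega_0}(x))$, be its associated skew-product, and put $\bar m=\mathbb P\times m$. Assume that $F$ is $\bar m$-nonsingular. Then $f$ satisfies (FPM) with respect to $m$ if and only if $F$ satisfies (FPM) with respect to $\bar m$.
   Context: Notation: $f_t=f(t,\cdot)$, $\omega=(\omega_i)_{i\ge0}$, $\sigma$ is the shift on $\Omega$, $f^0_\omega=\mathrm{id}$ and $f^n_\omega=f_{\omega_{n-1}}\circ\dots\circ f_{\omega_0}$ for $n\ge 1$. Nonsingularity: a measurable transformation $g$ of a probability space $(Y,\mathscr G,\eta)$ is $\eta$-nonsingular if the preimage under $g$ of every $\eta$-null set is $\eta$-null. Stationary measures: a probability measure $\mu$ on $X$ is $f$-stationary if $\mu=\int f_t\mu\,dp(t)$, where $f_t\mu$ is the pushforward; equivalently $\mathbb P\times\mu$ is $F$-invariant. It is ergodic if $\mathbb P\times\mu$ is ergodic for $F$. Support: the support of a probability measure $\mu$ up to an $\eta$-null set is any measurable $S$ with $\mu(Y\setminus S)=0$ and such that every measurable $A\subset S$ with $\mu(A)=0$ has $\eta(A)=0$. (FPM) for $f$ with respect to $m$: there are finitely many ergodic $f$-stationary probability measures $\mu_1,\dots,\mu_r$ on $X$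 such that 1) each $\mu_i$ is absolutely continuous with respect to $m$; 2) their supports are pairwise disjoint up to an $m$-null set; 3) for every bounded measurable $\psi:X\to\mathbb R$, $m(B_\omega(\mu_1,\psi)\cup\dots\cup B_\omega(\mu_r,\psi))=1$ for $\mathbb P$-a.e. $\omega$, where $B_\omega(\mu_i,\psi)=\{x\in X:\lim_{n\to\infty}\frac1n\sum_{j=0}^{n-1}\psi(f^j_\omega(x))=\int\psi\,d\mu_i\}$. $\mathbb P$-Markovian measure: an $F$-invariant probability measure $\bar\mu$ on $\Omega\times X$ whose first marginal is $\mathbb P$ and which admits a disintegration $d\bar\mu=\bar\mu_{\omega_0}\,d\mathbb P(\omega)$, i.e. with fiber measures depending only on the coordinate $\omega_0$. (FPM) for $F$ with respect to $\bar m$: there are finitely many ergodic $F$-invariant probability measures $\bar\mu_1,\dots,\bar\mu_r$ on $\Omega\times X$ such that 1) each $\bar\mu_i$ is $\mathbb P$-Markovian; 2) $\bar\mu_i\ll\bar m$ for each $i$; 3) for every bounded measurable $\varphi:\Omega\times X\to\mathbb R$, $\bar m(B(\bar\mu_1,\varphi)\cup\dots\cup B(\bar\mu_r,\varphi))=1$, where $B(\bar\mu_i,\varphi)=\{(\omega,x):\lim_{n\to\infty}\frac1n\sum_{j=0}^{n-1}\varphi(F^j(\omega,x))=\int\varphi\,d\bar\mu_i\}$. *)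

theory Defs
  imports "HOL-Probability.Probability"
begin

abbreviation seq_measure :: "'t measure \<Rightarrow> (nat \<Rightarrow> 't) measure" where
  "seq_measure p \<equiv> (\<Pi>\<^sub>M i\<in>UNIV. p)"

definition shift :: "(nat \<Rightarrow> 't) \<Rightarrow> nat \<Rightarrow> 't" where
  "shift \<omega> = (\<lambda>n. \<omega> (Suc n))"

primrec cocycle :: "('t \<Rightarrow> 'x \<Rightarrow> 'x) \<Rightarrow> (nat \<Rightarrow> 't) \<Rightarrow> nat \<Rightarrow> 'x \<Rightarrow> 'x" where
  "cocycle f \<omega> 0 = id"
| "cocycle f \<omega> (Suc n) = f (\<omega> n) \<circ> cocycle f \<omega> n"

definition skew_product :: "('t \<Rightarrow> 'x \<Rightarrow> 'x) \<Rightarrow> (nat \<Rightarrow> 't) \<times> 'x \<Rightarrow> (nat \<Rightarrow> 't) \<times> 'x" where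
  "skew_product f = (\<lambda>(\<omega>, x). (shift \<omega>, f (\<omega> 0) x))"

definition nonsingular :: "'a measure \<Rightarrow> ('a \<Rightarrow> 'a) \<Rightarrow> bool" where
  "nonsingular M g \<longleftrightarrow>
     g \<in> M \<rightarrow>\<^sub>M M \<and> (\<forall>A\<in>null_sets M. g -` A \<inter> space M \<in> null_sets M)"

definition invariant :: "'a measure \<Rightarrow> ('a \<Rightarrow> 'a) \<Rightarrow> bool" where
  "invariant M g \<longleftrightarrow> g \<in> M \<rightarrow>\<^sub>M M \<and> distr M M g = M"

definition ergodic :: "'a measure \<Rightarrow> ('a \<Rightarrow> 'a) \<Rightarrow> bool" where
  "ergodic M g \<longleftrightarrow> prob_space M \<and> invariant M g \<and>
     (\<forall>A\<in>sets M. g -` A \<inter> space M = A \<longrightarrow> emeasure M A = 0 \<or> emeasure M A = 1)"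

definition stationary :: "'t measure \<Rightarrow> ('t \<Rightarrow> 'x \<Rightarrow> 'x) \<Rightarrow> 'x measure \<Rightarrow> bool" where
  "stationary p f \<mu> \<longleftrightarrow> prob_space \<mu> \<and>
     (\<forall>A\<in>sets \<mu>. emeasure \<mu> A = (\<integral>\<^sup>+t. emeasure (distr \<mu> \<mu> (f t)) A \<partial>p))"

definition ergodic_stationary :: "'t measure \<Rightarrow> ('t \<Rightarrow> 'x \<Rightarrow> 'x) \<Rightarrow> 'x measure \<Rightarrow> bool" where
  "ergodic_stationary p f \<mu> \<longleftrightarrow>
     stationary p f \<mu> \<and> ergodic (seq_measure p \<Otimes>\<^sub>M \<mu>) (skew_product f)"

text \<open>\<open>S\<close> is a version of the support of \<open>\<mu>\<close>, which is determined up to an \<open>\<eta>\<close>-null set.\<close>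

definition support_mod :: "'a measure \<Rightarrow> 'a measure \<Rightarrow> 'a set \<Rightarrow> bool" where
  "support_mod \<eta> \<mu> S \<longleftrightarrow> S \<in> sets \<eta> \<and> emeasure \<mu> (space \<eta> - S) = 0 \<and>
     (\<forall>A\<in>sets \<eta>. A \<subseteq> S \<longrightarrow> emeasure \<mu> A = 0 \<longrightarrow> emeasure \<eta> A = 0)"

definition fiber_basin ::
    "('t \<Rightarrow> 'x \<Rightarrow> 'x) \<Rightarrow> (nat \<Rightarrow> 't) \<Rightarrow> 'x measure \<Rightarrow> ('x \<Rightarrow> real) \<Rightarrow> 'x set" where
  "fiber_basin f \<omega> \<mu> \<psi> = {x \<in> space \<mu>.
     (\<lambda>n. (\<Sum>j<n. \<psi> (cocycle f \<omega> j x)) / real n) \<longlonglongrightarrow> (\<integral>y. \<psi> y \<partial>\<mu>)}"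

definition basin :: "('a \<Rightarrow> 'a) \<Rightarrow> 'a measure \<Rightarrow> ('a \<Rightarrow> real) \<Rightarrow> 'a set" where
  "basin g \<mu> \<phi> = {z \<in> space \<mu>.
     (\<lambda>n. (\<Sum>j<n. \<phi> ((g ^^ j) z)) / real n) \<longlonglongrightarrow> (\<integral>y. \<phi> y \<partial>\<mu>)}"

text \<open>In both finiteness properties, \<open>r = 0\<close> is excluded by the last condition, since the empty
  union has measure \<open>0\<close>. Likewise, \<open>emeasure\<close> of a non-measurable set is \<open>0\<close>, so these
  conditions include the measurability of the unions of basins.\<close>

definition FPM :: "'t measure \<Rightarrow> 'x measure \<Rightarrow> ('t \<Rightarrow> 'x \<Rightarrow> 'x) \<Rightarrow> bool" where
  "FPM p m f \<longleftrightarrow> (\<exists>(r::nat) (\<mu> :: nat \<Rightarrow> 'x measure).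
     (\<forall>i\<in>{1..r}. sets (\<mu> i) = sets m \<and> ergodic_stationary p f (\<mu> i)) \<and>
     (\<forall>i\<in>{1..r}. absolutely_continuous m (\<mu> i)) \<and>
     (\<exists>S. (\<forall>i\<in>{1..r}. support_mod m (\<mu> i) (S i)) \<and>
          (\<forall>i\<in>{1..r}. \<forall>j\<in>{1..r}. i \<noteq> j \<longrightarrow> emeasure m (S i \<inter> S j) = 0)) \<and>
     (\<forall>\<psi> :: 'x \<Rightarrow> real. \<psi> \<in> borel_measurable m \<longrightarrow> bounded (\<psi> ` space m) \<longrightarrow>
        (AE \<omega> in seq_measure p. emeasure m (\<Union>i\<in>{1..r}. fiber_basin f \<omega> (\<mu> i) \<psi>) = 1)))"

text \<open>The fiber measures depend on \<open>\<omega>\<close> only through \<open>\<omega> 0\<close>, hence are given by a probability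
  kernel \<open>\<kappa>\<close> from \<open>p\<close> to \<open>m\<close>; only the \<open>\<sigma>\<close>-algebra of \<open>m\<close> matters.\<close>

definition markovian ::
    "'t measure \<Rightarrow> 'x measure \<Rightarrow> ('t \<Rightarrow> 'x \<Rightarrow> 'x) \<Rightarrow> ((nat \<Rightarrow> 't) \<times> 'x) measure \<Rightarrow> bool" where
  "markovian p m f \<nu> \<longleftrightarrow>
     prob_space \<nu> \<and> sets \<nu> = sets (seq_measure p \<Otimes>\<^sub>M m) \<and> invariant \<nu> (skew_product f) \<and>
     distr \<nu> (seq_measure p) fst = seq_measure p \<and>
     (\<exists>\<kappa> \<in> p \<rightarrow>\<^sub>M prob_algebra m. \<forall>A\<in>sets \<nu>.
        emeasure \<nu> A = (\<integral>\<^sup>+\<omega>. emeasure (\<kappa> (\<omega> 0)) (Pair \<omega> -` A) \<partial>seq_measure p))"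

definition FPM_skew :: "'t measure \<Rightarrow> 'x measure \<Rightarrow> ('t \<Rightarrow> 'x \<Rightarrow> 'x) \<Rightarrow> bool" where
  "FPM_skew p m f \<longleftrightarrow> (\<exists>(r::nat) (\<nu> :: nat \<Rightarrow> ((nat \<Rightarrow> 't) \<times> 'x) measure).
     (\<forall>i\<in>{1..r}. sets (\<nu> i) = sets (seq_measure p \<Otimes>\<^sub>M m) \<and> ergodic (\<nu> i) (skew_product f)) \<and>
     (\<forall>i\<in>{1..r}. markovian p m f (\<nu> i)) \<and>
     (\<forall>i\<in>{1..r}. absolutely_continuous (seq_measure p \<Otimes>\<^sub>M m) (\<nu> i)) \<and>
     (\<forall>\<phi> :: (nat \<Rightarrow> 't) \<times> 'x \<Rightarrow> real. \<phi> \<in> borel_measurable (seq_measure p \<Otimes>\<^sub>M m) \<longrightarrow>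
        bounded (\<phi> ` space (seq_measure p \<Otimes>\<^sub>M m)) \<longrightarrow>
        emeasure (seq_measure p \<Otimes>\<^sub>M m) (\<Union>i\<in>{1..r}. basin (skew_product f) (\<nu> i) \<phi>) = 1))"

end

theory Submission
  imports Defs
begin

text \<open>Why the two properties agree. Markovian \<open>F\<close>-invariant measures are nothing but the products
  \<open>P \<Otimes>\<^sub>M \<mu>\<close> with \<open>\<mu>\<close> stationary: invariance and the independence of \<open>\<omega> 0\<close> from the shifted sequence
  erase the dependence of the fiber measures on \<open>\<omega> 0\<close> (\<open>markovian_imp_product\<close>). So both properties
  concern the same measures, and only the disjointness of supports and the class of observables differ.

  From \<open>F\<close> to \<open>f\<close>: observables on \<open>X\<close> are special observables on \<open>\<Omega> \<times> X\<close>, and Fubini relates their basins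
  (\<open>fiber_basins_full_iff\<close>). Distinct ergodic measures have disjoint basins for a suitable
  observable, hence supports that are disjoint up to a null set (\<open>ergodic_supports_disjoint\<close>).

  From \<open>f\<close> to \<open>F\<close>: an observable on \<open>\<Omega> \<times> X\<close> that depends on \<open>\<omega>\<close> cannot be treated by restriction to fibers.
  Instead, Birkhoff's theorem shows that almost every point above the supports lies in a basin, the
  hypothesis for the indicator of the union of the supports shows that almost every orbit reaches that union,
  and nonsingularity ensures that it reaches it outside the exceptional null set
  (\<open>skew_basins_full\<close>).

  The form of Birkhoff's theorem needed here, for ergodic measures only, follows from the maximal
  ergodic lemma by Garsia's short argument.\<close>

section \<open>The ergodic theorem for ergodic measures\<close>

text \<open>The maximum of \<open>0\<close> and the Birkhoff sums of length at most \<open>n\<close>. The recursion, rather than a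
  maximum over a set, is what makes integrability and the comparison with \<open>max_birkhoff_sum g \<phi> n (g z)\<close>
  immediate.\<close>

primrec max_birkhoff_sum :: "('a \<Rightarrow> 'a) \<Rightarrow> ('a \<Rightarrow> real) \<Rightarrow> nat \<Rightarrow> 'a \<Rightarrow> real" where
  "max_birkhoff_sum g \<phi> 0 z = 0"
| "max_birkhoff_sum g \<phi> (Suc n) z = max 0 (\<phi> z + max_birkhoff_sum g \<phi> n (g z))"

lemma birkhoff_sum_Suc:
  "(\<Sum>j<Suc n. \<phi> ((g ^^ j) z)) = \<phi> z + (\<Sum>j<n. \<phi> ((g ^^ j) (g z)))" for \<phi> :: "'a \<Rightarrow> real"
  by (simp only: sum.lessThan_Suc_shift funpow_Suc_right comp_apply funpow_0)

lemma max_birkhoff_sum_nonneg: "0 \<le> max_birkhoff_sum g \<phi> n z"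
  by (cases n) auto

lemma max_birkhoff_sum_mono: "max_birkhoff_sum g \<phi> n z \<le> max_birkhoff_sum g \<phi> (Suc n) z"
proof (induction n arbitrary: z)
  case (Suc n)
  show ?case using Suc[of "g z"] by simp
qed simp

lemma birkhoff_sum_le_max: "(\<Sum>j<n. \<phi> ((g ^^ j) z)) \<le> max_birkhoff_sum g \<phi> n z"
proof (induction n arbitrary: z)
  case (Suc n)
  show ?case using Suc[of "g z"] unfolding birkhoff_sum_Suc by simp
qed simp

lemma measurable_funpow [measurable (raw)]:
  assumes "g \<in> M \<rightarrow>\<^sub>M M"
  shows "g ^^ n \<in> M \<rightarrow>\<^sub>M M"
proof (induction n)
  case (Suc n)
  show ?case unfolding funpow.simps by (rule measurable_comp[OF Suc assms])
qed simp

lemma funpow_in_space: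
  assumes "g \<in> M \<rightarrow>\<^sub>M M" "z \<in> space M"
  shows "(g ^^ n) z \<in> space M"
  using measurable_space[OF measurable_funpow[OF assms(1)] assms(2)] .

lemma measurable_birkhoff_sum [measurable (raw)]:
  fixes \<phi> :: "'a \<Rightarrow> real"
  assumes [measurable]: "g \<in> M \<rightarrow>\<^sub>M M" "\<phi> \<in> borel_measurable M"
  shows "(\<lambda>z. \<Sum>j<n. \<phi> ((g ^^ j) z)) \<in> borel_measurable M"
  by measurable

lemma integrable_invariant:
  fixes \<phi> :: "'a \<Rightarrow> real"
  assumes "invariant M g" "integrable M \<phi>"
  shows "integrable M (\<lambda>z. \<phi> (g z))" "(\<integral>z. \<phi> (g z) \<partial>M) = (\<integral>z. \<phi> z \<partial>M)"
proof -
  have g: "g \<in> M \<rightarrow>\<^sub>M M" and d: "distr M M g = M"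
    using assms(1) by (auto simp: invariant_def)
  show "integrable M (\<lambda>z. \<phi> (g z))"
    using assms(2) by (intro integrable_distr[OF g]) (simp add: d)
  show "(\<integral>z. \<phi> (g z) \<partial>M) = (\<integral>z. \<phi> z \<partial>M)"
    using integral_distr[OF g borel_measurable_integrable[OF assms(2)]] by (simp add: d)
qed

text \<open>Integrability by induction along the recursion, so that the integral of the maximum can be
  compared with that of its composition with \<open>g\<close> without any \<open>\<infinity> - \<infinity>\<close>.\<close>

lemma integrable_max_birkhoff_sum:
  assumes "invariant M g" "integrable M \<phi>"
  shows "integrable M (max_birkhoff_sum g \<phi> n)"
proof (induction n)
  case (Suc n)
  have "integrable M (\<lambda>z. max 0 (\<phi> z + max_birkhoff_sum g \<phi> n (g z)))"
    by (intro integrable_max integrable_zero Bochner_Integration.integrable_add assms(2)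
        integrable_invariant(1)[OF assms(1) Suc])
  then show ?case by (simp add: max_birkhoff_sum.simps(2)[abs_def])
qed (simp add: max_birkhoff_sum.simps(1)[abs_def])

text \<open>Garsia's argument. Write \<open>S n\<close> for the maximal sums and \<open>E\<close> for the set where \<open>S (n + 1) > 0\<close>. On
  \<open>E\<close> the recursion gives \<open>\<phi> = S (n + 1) - S n \<circ> g\<close>; off \<open>E\<close> the right-hand side is at most
  \<open>0\<close>. Integrating, invariance turns \<open>S n \<circ> g\<close> into \<open>S n\<close>, which is at most \<open>S (n + 1)\<close>.\<close>

lemma maximal_ergodic_step:
  assumes "invariant M g" "integrable M \<phi>"
  shows "0 \<le> (\<integral>z. indicator {z\<in>space M. 0 < max_birkhoff_sum g \<phi> (Suc n) z} z * \<phi> z \<partial>M)"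
proof -
  let ?S = "max_birkhoff_sum g \<phi>"
  define E where "E = {z\<in>space M. 0 < ?S (Suc n) z}"
  note I = integrable_max_birkhoff_sum[OF assms]
  have [measurable]: "?S k \<in> borel_measurable M" for k
    using I by blast
  have E: "E \<in> sets M" unfolding E_def by measurable
  have Iphi: "integrable M (\<lambda>z. indicator E z * \<phi> z)"
    using integrable_mult_indicator[OF E assms(2)] by simp
  have Ig: "integrable M (\<lambda>z. ?S n (g z))"
    by (rule integrable_invariant(1)[OF assms(1) I])
  have "?S (Suc n) z - ?S n (g z) \<le> indicator E z * \<phi> z" if "z \<in> space M" for z
  proof (cases "z \<in> E")
    case True
    then have "?S (Suc n) z = \<phi> z + ?S n (g z)" by (auto simp: E_def max_def split: if_splits)
    with True show ?thesis by simp
  next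
    case False
    then have "?S (Suc n) z = 0"
      using that max_birkhoff_sum_nonneg[of g \<phi> "Suc n" z] by (auto simp: E_def)
    then show ?thesis
      using False max_birkhoff_sum_nonneg[of g \<phi> n "g z"] by simp
  qed
  then have "(\<integral>z. ?S (Suc n) z - ?S n (g z) \<partial>M) \<le> (\<integral>z. indicator E z * \<phi> z \<partial>M)"
    by (intro integral_mono I Ig Iphi Bochner_Integration.integrable_diff)
  moreover have "(\<integral>z. ?S (Suc n) z - ?S n (g z) \<partial>M) = (\<integral>z. ?S (Suc n) z \<partial>M) - (\<integral>z. ?S n z \<partial>M)"
    by (simp only: Bochner_Integration.integral_diff[OF I Ig] integrable_invariant(2)[OF assms(1) I])
  moreover have "(\<integral>z. ?S n z \<partial>M) \<le> (\<integral>z. ?S (Suc n) z \<partial>M)"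
    by (intro integral_mono I max_birkhoff_sum_mono)
  ultimately show ?thesis unfolding E_def by linarith
qed

text \<open>The sets of the finite maximal inequality increase to a set of full measure, and dominated
  convergence passes the inequality to the limit.\<close>

lemma maximal_ergodic:
  fixes \<phi> :: "'a \<Rightarrow> real"
  assumes "invariant M g" "integrable M \<phi>"
    and pos: "AE z in M. \<exists>n. 0 < (\<Sum>j<n. \<phi> ((g ^^ j) z))"
  shows "0 \<le> (\<integral>z. \<phi> z \<partial>M)"
proof -
  let ?S = "max_birkhoff_sum g \<phi>"
  define E where "E n = {z\<in>space M. 0 < ?S (Suc n) z}" for n
  have [measurable]: "?S k \<in> borel_measurable M" for k
    using integrable_max_birkhoff_sum[OF assms(1,2)] by blast
  have [measurable]: "E n \<in> sets M" for n unfolding E_def by measurable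
  have [measurable]: "\<phi> \<in> borel_measurable M" using assms(2) by blast
  have "(\<lambda>n. \<integral>z. indicator (E n) z * \<phi> z \<partial>M) \<longlonglongrightarrow> (\<integral>z. \<phi> z \<partial>M)"
  proof (rule integral_dominated_convergence[where w = "\<lambda>z. \<bar>\<phi> z\<bar>"])
    show "integrable M (\<lambda>z. \<bar>\<phi> z\<bar>)" using assms(2) by simp
    show "AE z in M. (\<lambda>n. indicator (E n) z * \<phi> z) \<longlonglongrightarrow> \<phi> z"
      using pos AE_space
    proof eventually_elim
      case (elim z)
      then obtain k where k: "0 < (\<Sum>j<k. \<phi> ((g ^^ j) z))" by blast
      have mono: "incseq (\<lambda>n. ?S n z)" by (intro incseq_SucI max_birkhoff_sum_mono)
      have "z \<in> E n" if "k \<le> n" for n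
      proof -
        have "?S k z \<le> ?S (Suc n) z" using that by (intro incseqD[OF mono]) simp
        then show ?thesis
          using k birkhoff_sum_le_max[of \<phi> g z k] elim by (simp add: E_def del: max_birkhoff_sum.simps)
      qed
      then have "eventually (\<lambda>n. indicator (E n) z * \<phi> z = \<phi> z) sequentially"
        by (intro eventually_sequentiallyI[of k]) simp
      then show ?case by (rule tendsto_eventually)
    qed
    show "AE z in M. norm (indicator (E n) z * \<phi> z) \<le> \<bar>\<phi> z\<bar>" for n
      by (auto simp: indicator_def)
  qed measurable
  then show ?thesis
    by (rule LIMSEQ_le_const) (use maximal_ergodic_step[OF assms(1,2)] in \<open>auto simp: E_def\<close>)
qed

text \<open>Dropping the first term of a Birkhoff sum and replacing \<open>n + 1\<close> by \<open>n\<close> in the denominator are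
  both asymptotically invisible. The identity is exact at every point, which matters because ergodicity
  speaks of sets that are strictly invariant.\<close>

lemma limsup_birkhoff_average_invariant:
  fixes \<phi> :: "'a \<Rightarrow> real"
  shows "limsup (\<lambda>n. ereal ((\<Sum>j<n. \<phi> ((g ^^ j) (g z))) / real n)) =
         limsup (\<lambda>n. ereal ((\<Sum>j<n. \<phi> ((g ^^ j) z)) / real n))"
proof -
  define A where "A n = (\<Sum>j<n. \<phi> ((g ^^ j) z)) / real n" for n
  \<comment> \<open>At \<open>n = 0\<close> both sides vanish, division by zero being zero.\<close>
  have eq: "ereal ((\<Sum>j<n. \<phi> ((g ^^ j) (g z))) / real n) =
      ereal (- \<phi> z / real n) + ereal (real (Suc n) / real n) * ereal (A (Suc n))" for n
  proof -
    have "real (Suc n) / real n * A (Suc n) = (\<Sum>j<Suc n. \<phi> ((g ^^ j) z)) / real n"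
      by (simp add: A_def del: sum.lessThan_Suc of_nat_Suc)
    then show ?thesis
      by (simp add: birkhoff_sum_Suc add_divide_distrib del: sum.lessThan_Suc of_nat_Suc)
  qed
  have "(\<lambda>n. - \<phi> z / real n) \<longlonglongrightarrow> 0"
    by (rule lim_const_over_n)
  then have 1: "(\<lambda>n. ereal (- \<phi> z / real n)) \<longlonglongrightarrow> 0"
    by (simp add: zero_ereal_def)
  have "(\<lambda>n. real (Suc n) / real n) \<longlonglongrightarrow> 1"
    using LIMSEQ_Suc_n_over_n .
  then have 2: "(\<lambda>n. ereal (real (Suc n) / real n)) \<longlonglongrightarrow> 1"
    by (simp add: one_ereal_def)
  have "limsup (\<lambda>n. ereal (- \<phi> z / real n) + ereal (real (Suc n) / real n) * ereal (A (Suc n)))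
      = 0 + 1 * limsup (\<lambda>n. ereal (A (Suc n)))"
    by (subst ereal_limsup_lim_add[OF 1], simp, subst ereal_limsup_lim_mult[OF 2]) simp_all
  then show ?thesis
    using limsup_shift[of "\<lambda>n. ereal (A n)"] by (simp add: eq flip: A_def)
qed

text \<open>Basins are closed under preimages. This is what allows a point to be classified by the basin
  that its orbit eventually enters.\<close>

lemma birkhoff_average_tendsto_pullback:
  fixes \<phi> :: "'a \<Rightarrow> real"
  assumes "(\<lambda>n. (\<Sum>j<n. \<phi> ((g ^^ j) (g z))) / real n) \<longlonglongrightarrow> c"
  shows "(\<lambda>n. (\<Sum>j<n. \<phi> ((g ^^ j) z)) / real n) \<longlonglongrightarrow> c"
proof -
  have neg: "(\<Sum>j<n. - \<phi> (h j)) / real n = - ((\<Sum>j<n. \<phi> (h j)) / real n)" for h n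
    by (simp add: sum_negf)
  have "limsup (\<lambda>n. ereal ((\<Sum>j<n. \<phi> ((g ^^ j) z)) / real n)) = c"
    using lim_imp_Limsup[OF sequentially_bot tendsto_ereal[OF assms]]
    by (simp add: limsup_birkhoff_average_invariant)
  moreover have "liminf (\<lambda>n. ereal ((\<Sum>j<n. \<phi> ((g ^^ j) z)) / real n)) = c"
    using lim_imp_Liminf[OF sequentially_bot tendsto_ereal[OF assms]]
      limsup_birkhoff_average_invariant[of "\<lambda>z. - \<phi> z" g z]
    by (simp add: neg ereal_Limsup_uminus flip: uminus_ereal.simps)
  ultimately show ?thesis by (intro limsup_le_liminf_real) auto
qed

text \<open>For every \<open>a\<close> above the integral, the set where the upper limit exceeds \<open>a\<close> is invariant, hence
  null or of full measure. In the second case almost every point has a positive Birkhoff sum of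
  \<open>\<phi> - a\<close>, and the maximal ergodic lemma would make the integral of \<open>\<phi> - a\<close> nonnegative.\<close>

lemma limsup_birkhoff_average_le:
  assumes "ergodic M g" "integrable M \<phi>"
  shows "AE z in M. limsup (\<lambda>n. ereal ((\<Sum>j<n. \<phi> ((g ^^ j) z)) / real n)) \<le> (\<integral>z. \<phi> z \<partial>M)"
proof -
  interpret prob_space M using assms(1) by (simp add: ergodic_def)
  have inv: "invariant M g" and [measurable]: "g \<in> M \<rightarrow>\<^sub>M M"
    using assms(1) by (auto simp: ergodic_def invariant_def)
  have [measurable]: "\<phi> \<in> borel_measurable M" using assms(2) by blast
  let ?L = "\<lambda>z. limsup (\<lambda>n. ereal ((\<Sum>j<n. \<phi> ((g ^^ j) z)) / real n))"
  have *: "AE z in M. ?L z \<le> ereal a" if a: "(\<integral>z. \<phi> z \<partial>M) < a" for a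
  proof -
    let ?A = "{z\<in>space M. ereal a < ?L z}"
    have A: "?A \<in> sets M" by measurable
    have "g -` ?A \<inter> space M = ?A"
      using measurable_space[OF \<open>g \<in> M \<rightarrow>\<^sub>M M\<close>]
      by (auto simp: limsup_birkhoff_average_invariant)
    then have "emeasure M ?A = 0 \<or> emeasure M ?A = 1"
      using assms(1) A by (auto simp: ergodic_def)
    moreover have "emeasure M ?A \<noteq> 1"
    proof
      assume "emeasure M ?A = 1"
      then have "AE z in M. z \<in> ?A" using AE_prob_1[of ?A] by (simp add: measure_def)
      then have "AE z in M. \<exists>n. 0 < (\<Sum>j<n. \<phi> ((g ^^ j) z) - a)"
      proof eventually_elim
        case (elim z)
        have "\<exists>\<^sub>F n in sequentially. ereal a < ereal ((\<Sum>j<n. \<phi> ((g ^^ j) z)) / real n)"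
        proof (rule ccontr)
          assume "\<not> ?thesis"
          then have "\<forall>\<^sub>F n in sequentially. ereal ((\<Sum>j<n. \<phi> ((g ^^ j) z)) / real n) \<le> ereal a"
            by (simp add: not_frequently not_less)
          then have "?L z \<le> ereal a" by (rule Limsup_bounded)
          moreover have "ereal a < ?L z" using elim by simp
          ultimately show False by (meson leD)
        qed
        then have "\<exists>\<^sub>F n in sequentially. ereal a < ereal ((\<Sum>j<n. \<phi> ((g ^^ j) z)) / real n) \<and> 0 < n"
          by (rule frequently_eventually_frequently) (rule eventually_gt_at_top)
        then obtain n where "a < (\<Sum>j<n. \<phi> ((g ^^ j) z)) / real n" "0 < n"
          by (auto dest: frequently_ex)
        then have "0 < (\<Sum>j<n. \<phi> ((g ^^ j) z) - a)"
          by (simp add: sum_subtractf field_simps)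
        then show ?case ..
      qed
      then have "0 \<le> (\<integral>z. \<phi> z - a \<partial>M)"
        using assms(2) by (intro maximal_ergodic[OF inv]) auto
      then show False using a assms(2) by (simp add: prob_space)
    qed
    ultimately have "AE z in M. z \<notin> ?A" using A by (intro AE_not_in null_setsI) simp_all
    with AE_space show ?thesis
      by eventually_elim (simp add: not_less)
  qed
  have "AE z in M. \<forall>k. ?L z \<le> ereal ((\<integral>z. \<phi> z \<partial>M) + 1 / real (Suc k))"
    by (subst AE_all_countable) (auto intro!: *)
  then show ?thesis
  proof eventually_elim
    case (elim z)
    have "(\<lambda>k. (\<integral>z. \<phi> z \<partial>M) + 1 / real (Suc k)) \<longlonglongrightarrow> (\<integral>z. \<phi> z \<partial>M) + 0"
      by (intro tendsto_intros LIMSEQ_Suc[OF lim_const_over_n])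
    then have "(\<lambda>k. ereal ((\<integral>z. \<phi> z \<partial>M) + 1 / real (Suc k))) \<longlonglongrightarrow> ereal (\<integral>z. \<phi> z \<partial>M)"
      by simp
    then show ?case by (rule LIMSEQ_le_const) (use elim in auto)
  qed
qed

text \<open>Birkhoff's theorem for ergodic measures: the upper bound applied to \<open>\<phi>\<close> and to \<open>- \<phi>\<close>.\<close>

lemma birkhoff_ergodic:
  assumes "ergodic M g" "integrable M \<phi>"
  shows "AE z in M. (\<lambda>n. (\<Sum>j<n. \<phi> ((g ^^ j) z)) / real n) \<longlonglongrightarrow> (\<integral>z. \<phi> z \<partial>M)"
proof -
  have neg: "(\<Sum>j<n. - \<phi> (h j)) / real n = - ((\<Sum>j<n. \<phi> (h j)) / real n)" for h n
    by (simp add: sum_negf)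
  have "AE z in M. limsup (\<lambda>n. ereal ((\<Sum>j<n. - \<phi> ((g ^^ j) z)) / real n)) \<le> (\<integral>z. - \<phi> z \<partial>M)"
    using assms by (intro limsup_birkhoff_average_le) auto
  with limsup_birkhoff_average_le[OF assms] show ?thesis
  proof eventually_elim
    case (elim z)
    from elim(2) have "ereal (\<integral>z. \<phi> z \<partial>M) \<le> liminf (\<lambda>n. ereal ((\<Sum>j<n. \<phi> ((g ^^ j) z)) / real n))"
      by (simp add: neg ereal_Limsup_uminus ereal_uminus_le_reorder flip: uminus_ereal.simps)
    with elim(1) show ?case by (rule limsup_le_liminf_real)
  qed
qed

text \<open>The basin is measurable for a reference measure \<open>N\<close> with the same \<open>\<sigma>\<close>-algebra as \<open>\<nu>\<close>; in the
  application \<open>N\<close> is \<open>P \<Otimes>\<^sub>M m\<close> and \<open>\<nu>\<close> one of the invariant measures.\<close>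

lemma sets_basin:
  assumes "g \<in> N \<rightarrow>\<^sub>M N" "\<phi> \<in> borel_measurable N" "sets \<nu> = sets N"
  shows "basin g \<nu> \<phi> \<in> sets N"
proof -
  have "g \<in> \<nu> \<rightarrow>\<^sub>M \<nu>" "\<phi> \<in> borel_measurable \<nu>"
    using assms by (simp_all cong: measurable_cong_sets)
  note [measurable] = this
  have "basin g \<nu> \<phi> = {z\<in>space \<nu>.
      liminf (\<lambda>n. ereal ((\<Sum>j<n. \<phi> ((g ^^ j) z)) / real n)) = ereal (\<integral>y. \<phi> y \<partial>\<nu>) \<and>
      limsup (\<lambda>n. ereal ((\<Sum>j<n. \<phi> ((g ^^ j) z)) / real n)) = ereal (\<integral>y. \<phi> y \<partial>\<nu>)}"
    unfolding basin_def lim_ereal[symmetric] tendsto_iff_Liminf_eq_Limsup[OF sequentially_bot] ..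
  also have "\<dots> \<in> sets \<nu>" by measurable
  finally show ?thesis by (simp add: assms(3))
qed

lemma AE_in_basin:
  assumes "ergodic \<nu> g" "integrable \<nu> \<phi>"
  shows "AE z in \<nu>. z \<in> basin g \<nu> \<phi>"
  using birkhoff_ergodic[OF assms] by (auto simp: basin_def)

lemma basin_pullback:
  assumes "g z \<in> basin g \<nu> \<phi>" "z \<in> space \<nu>"
  shows "z \<in> basin g \<nu> \<phi>"
  using assms birkhoff_average_tendsto_pullback[of \<phi> g z] by (simp add: basin_def)

section \<open>Null sets in products, supports and nonsingular maps\<close>

lemma emeasure_eq_0_if_AE_not_in:
  assumes "AE x in M. x \<notin> E"
  shows "emeasure M E = 0"
  using assms AE_iff_null_sets[of E M] emeasure_notin_sets[of E M] by (cases "E \<in> sets M") auto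

lemma null_pair_measure_iff:
  assumes "sigma_finite_measure M" "N \<in> sets (L \<Otimes>\<^sub>M M)"
  shows "emeasure (L \<Otimes>\<^sub>M M) N = 0 \<longleftrightarrow> (AE x in L. emeasure M (Pair x -` N) = 0)"
  using assms by (simp add: sigma_finite_measure.emeasure_pair_measure_alt
      nn_integral_0_iff_AE sigma_finite_measure.measurable_emeasure_Pair)

lemma absolutely_continuous_pair:
  assumes "sigma_finite_measure M" "sigma_finite_measure K" "sets K = sets M"
    and ac: "absolutely_continuous M K"
  shows "absolutely_continuous (L \<Otimes>\<^sub>M M) (L \<Otimes>\<^sub>M K)"
  unfolding absolutely_continuous_def
proof
  fix N assume "N \<in> null_sets (L \<Otimes>\<^sub>M M)"
  then have N: "N \<in> sets (L \<Otimes>\<^sub>M M)" and "AE x in L. emeasure M (Pair x -` N) = 0"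
    using null_pair_measure_iff[OF assms(1)] by auto
  then have "AE x in L. emeasure K (Pair x -` N) = 0"
    using ac sets_Pair1[OF N]
    by (auto simp: absolutely_continuous_def null_sets_def subset_eq elim!: eventually_mono)
  moreover have "sets (L \<Otimes>\<^sub>M K) = sets (L \<Otimes>\<^sub>M M)"
    by (rule sets_pair_measure_cong[OF refl assms(3)])
  ultimately show "N \<in> null_sets (L \<Otimes>\<^sub>M K)"
    using null_pair_measure_iff[OF assms(2), of N L] N by auto
qed

text \<open>The set where the density is nonzero is a version of the support.\<close>

lemma support_mod_exists:
  assumes "sigma_finite_measure \<eta>" "absolutely_continuous \<eta> \<mu>" "sets \<mu> = sets \<eta>"
  shows "\<exists>S. support_mod \<eta> \<mu> S"
proof -
  obtain h where [measurable]: "h \<in> borel_measurable \<eta>" and h: "density \<eta> h = \<mu>"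
    using sigma_finite_measure.Radon_Nikodym[OF assms] by blast
  have null: "emeasure \<mu> A = 0 \<longleftrightarrow> (AE x in \<eta>. x \<in> A \<longrightarrow> h x = 0)" if "A \<in> sets \<eta>" for A
    using null_sets_density_iff[of h \<eta> A] that by (auto simp: h null_sets_def assms(3))
  let ?S = "{x\<in>space \<eta>. h x \<noteq> 0}"
  have S: "?S \<in> sets \<eta>" by measurable
  have "emeasure \<eta> A = 0" if A: "A \<in> sets \<eta>" "A \<subseteq> ?S" "emeasure \<mu> A = 0" for A
  proof -
    have "AE x in \<eta>. x \<notin> A"
      using A(3) unfolding null[OF A(1)] by eventually_elim (use A(2) in auto)
    then show ?thesis by (rule emeasure_eq_0_if_AE_not_in)
  qed
  with S have "support_mod \<eta> \<mu> ?S" by (simp add: support_mod_def null)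
  then show ?thesis ..
qed

text \<open>Over a support of \<open>\<mu>\<close>, the measure \<open>\<eta>\<close> is in turn absolutely continuous with respect to \<open>\<mu>\<close>.
  Fubini lifts this to products, so that almost sure statements for \<open>L \<Otimes>\<^sub>M \<mu>\<close> hold
  \<open>L \<Otimes>\<^sub>M \<eta>\<close>-almost surely above the support.\<close>

lemma null_over_support:
  assumes "sigma_finite_measure \<eta>" "sigma_finite_measure \<mu>" "sets \<mu> = sets \<eta>"
    and S: "support_mod \<eta> \<mu> S"
    and E: "E \<in> sets (L \<Otimes>\<^sub>M \<eta>)" "E \<subseteq> UNIV \<times> S" "emeasure (L \<Otimes>\<^sub>M \<mu>) E = 0"
  shows "emeasure (L \<Otimes>\<^sub>M \<eta>) E = 0"
proof -
  have "sets (L \<Otimes>\<^sub>M \<mu>) = sets (L \<Otimes>\<^sub>M \<eta>)"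
    by (rule sets_pair_measure_cong[OF refl assms(3)])
  then have "AE x in L. emeasure \<mu> (Pair x -` E) = 0"
    using null_pair_measure_iff[OF assms(2), of E L] E by simp
  then have "AE x in L. emeasure \<eta> (Pair x -` E) = 0"
  proof eventually_elim
    case (elim x)
    have "Pair x -` E \<subseteq> S" using E(2) by auto
    with elim S sets_Pair1[OF E(1)] show ?case by (simp add: support_mod_def)
  qed
  then show ?thesis using null_pair_measure_iff[OF assms(1) E(1)] by simp
qed

lemma distr_pair_snd:
  assumes "prob_space L" "sigma_finite_measure M"
  shows "distr (L \<Otimes>\<^sub>M M) M snd = M"
proof (intro measure_eqI)
  fix A assume "A \<in> sets (distr (L \<Otimes>\<^sub>M M) M snd)"
  then have A: "A \<in> sets M" by simp
  then have "snd -` A \<inter> space (L \<Otimes>\<^sub>M M) = space L \<times> A"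
    by (auto simp: space_pair_measure dest: sets.sets_into_space)
  with A show "emeasure (distr (L \<Otimes>\<^sub>M M) M snd) A = emeasure M A"
    using assms by (simp add: emeasure_distr prob_space.emeasure_space_1
        sigma_finite_measure.emeasure_pair_measure_Times)
qed simp

lemma null_sets_funpow:
  assumes "nonsingular M g" "N \<in> null_sets M"
  shows "(g ^^ n) -` N \<inter> space M \<in> null_sets M"
proof (induction n)
  case (Suc n)
  have "(g ^^ Suc n) -` N \<inter> space M = g -` ((g ^^ n) -` N \<inter> space M) \<inter> space M"
    using assms(1) by (auto simp: nonsingular_def funpow_Suc_right simp del: funpow.simps
        dest: measurable_space)
  with Suc assms(1) show ?case unfolding nonsingular_def by metis
next
  case 0
  have "N \<inter> space M = N" using assms(2) by (auto dest: sets.sets_into_space)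
  with assms(2) show ?case by simp
qed

section \<open>Random maps and their skew products\<close>

lemma shift_case_nat: "shift (case_nat t \<omega>) = \<omega>"
  by (simp add: shift_def)

lemma skew_product_funpow:
  "(skew_product f ^^ n) (\<omega>, x) = (\<lambda>i. \<omega> (i + n), cocycle f \<omega> n x)"
  by (induction n) (auto simp: skew_product_def shift_def)

locale random_map = p: prob_space p + m: prob_space m
  for p :: "'t measure" and m :: "'x measure" +
  fixes f :: "'t \<Rightarrow> 'x \<Rightarrow> 'x"
  assumes measurable_f: "(\<lambda>(t, x). f t x) \<in> p \<Otimes>\<^sub>M m \<rightarrow>\<^sub>M m"
begin

abbreviation "P \<equiv> seq_measure p"
abbreviation "F \<equiv> skew_product f"

sublocale seq: sequence_space p
  by unfold_locales

lemma prob_space_P: "prob_space P"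
  by (rule seq.P.prob_space_axioms)

lemma sets_pair_eq: "sets \<mu> = sets m \<Longrightarrow> sets (P \<Otimes>\<^sub>M \<mu>) = sets (P \<Otimes>\<^sub>M m)"
  by (rule sets_pair_measure_cong[OF refl])

lemma measurable_f_comp [measurable (raw)]:
  assumes "a \<in> M \<rightarrow>\<^sub>M p" "b \<in> M \<rightarrow>\<^sub>M m"
  shows "(\<lambda>z. f (a z) (b z)) \<in> M \<rightarrow>\<^sub>M m"
  using measurable_compose[OF measurable_Pair[OF assms] measurable_f] by simp

lemma measurable_shift [measurable]: "shift \<in> P \<rightarrow>\<^sub>M P"
  unfolding shift_def[abs_def] by (rule measurable_PiM_single') (auto simp: space_PiM)

lemma measurable_F [measurable]: "F \<in> P \<Otimes>\<^sub>M m \<rightarrow>\<^sub>M P \<Otimes>\<^sub>M m"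
  unfolding skew_product_def case_prod_beta by measurable

lemma distr_first_coordinate: "distr P p (\<lambda>\<omega>. \<omega> 0) = p"
  by (rule seq.PiM_component) simp

lemma nn_integral_first_coordinate:
  assumes "h \<in> borel_measurable p"
  shows "(\<integral>\<^sup>+\<omega>. h (\<omega> 0) \<partial>P) = (\<integral>\<^sup>+t. h t \<partial>p)"
proof -
  have "(\<integral>\<^sup>+t. h t \<partial>distr P p (\<lambda>\<omega>. \<omega> 0)) = (\<integral>\<^sup>+\<omega>. h (\<omega> 0) \<partial>P)"
    using assms by (intro nn_integral_distr) auto
  then show ?thesis by (simp add: distr_first_coordinate)
qed

text \<open>The first coordinate and the shifted sequence are independent, because prefixing a sequence with an
  independent \<open>p\<close>-distributed letter reproduces the infinite product.\<close>

lemma nn_integral_first_times_shift: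
  assumes [measurable]: "h \<in> borel_measurable p" "k \<in> borel_measurable P"
  shows "(\<integral>\<^sup>+\<omega>. h (\<omega> 0) * k (shift \<omega>) \<partial>P) = (\<integral>\<^sup>+t. h t \<partial>p) * (\<integral>\<^sup>+\<omega>. k \<omega> \<partial>P)"
proof -
  have "(\<integral>\<^sup>+\<omega>. h (\<omega> 0) * k (shift \<omega>) \<partial>P)
      = (\<integral>\<^sup>+\<omega>. h (\<omega> 0) * k (shift \<omega>) \<partial>distr (p \<Otimes>\<^sub>M P) P (\<lambda>(s, \<omega>). case_nat s \<omega>))"
    by (simp add: seq.PiM_iter)
  also have "\<dots> = (\<integral>\<^sup>+z. h (fst z) * k (snd z) \<partial>(p \<Otimes>\<^sub>M P))"
    by (subst nn_integral_distr) (simp_all add: split_beta shift_case_nat)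
  also have "\<dots> = (\<integral>\<^sup>+t. \<integral>\<^sup>+\<omega>. h t * k \<omega> \<partial>P \<partial>p)"
    by (subst seq.P.nn_integral_fst[symmetric]) auto
  also have "\<dots> = (\<integral>\<^sup>+t. h t \<partial>p) * (\<integral>\<^sup>+\<omega>. k \<omega> \<partial>P)"
    by (simp add: nn_integral_cmult nn_integral_multc)
  finally show ?thesis .
qed

text \<open>The key structural fact. If the fiber measures of an invariant \<open>\<nu>\<close> depend on \<open>\<omega> 0\<close> only, then
  \<open>\<nu> (F -` (A \<times> B))\<close> is the integral of \<open>\<kappa> (\<omega> 0) (f (\<omega> 0) -` B)\<close> over the \<open>\<omega>\<close> with \<open>shift \<omega> \<in> A\<close>.
  By independence this factors into \<open>P A\<close> and a number depending on \<open>B\<close> alone. By invariance it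
  equals \<open>\<nu> (A \<times> B)\<close>, so \<open>\<nu>\<close> is a product measure: after one step the dependence on \<open>\<omega> 0\<close> has been
  shifted away.\<close>

lemma markovian_imp_product:
  assumes "markovian p m f \<nu>"
  shows "\<nu> = P \<Otimes>\<^sub>M distr \<nu> m snd"
proof -
  have "prob_space \<nu>" and sets: "sets \<nu> = sets (P \<Otimes>\<^sub>M m)" and inv: "invariant \<nu> F"
    using assms unfolding markovian_def by blast+
  then interpret nu: prob_space \<nu> by blast
  obtain \<kappa> where \<kappa>: "\<kappa> \<in> p \<rightarrow>\<^sub>M prob_algebra m"
    and disint: "\<And>A. A \<in> sets \<nu> \<Longrightarrow>
      emeasure \<nu> A = (\<integral>\<^sup>+\<omega>. emeasure (\<kappa> (\<omega> 0)) (Pair \<omega> -` A) \<partial>P)"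
    using assms unfolding markovian_def by blast
  have space: "space \<nu> = space P \<times> space m"
    using sets_eq_imp_space_eq[OF sets] by (simp add: space_pair_measure)
  have snd [measurable]: "snd \<in> \<nu> \<rightarrow>\<^sub>M m"
    using sets by (simp cong: measurable_cong_sets)
  interpret mu: prob_space "distr \<nu> m snd"
    by (rule nu.prob_space_distr[OF snd])
  define c where "c B = (\<integral>\<^sup>+t. emeasure (\<kappa> t) (f t -` B \<inter> space m) \<partial>p)" for B
  have rect: "emeasure \<nu> (A \<times> B) = c B * emeasure P A"
    if A: "A \<in> sets P" and B: "B \<in> sets m" for A B
  proof -
    have AB: "A \<times> B \<in> sets \<nu>" using A B sets by simp
    have F: "F \<in> \<nu> \<rightarrow>\<^sub>M \<nu>" using inv by (simp add: invariant_def)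
    have "{z\<in>space (p \<Otimes>\<^sub>M m). f (fst z) (snd z) \<in> B} \<in> sets (p \<Otimes>\<^sub>M m)"
      using B by measurable
    also have "{z\<in>space (p \<Otimes>\<^sub>M m). f (fst z) (snd z) \<in> B} = (SIGMA t:space p. f t -` B \<inter> space m)"
      by (auto simp: space_pair_measure)
    finally have meas: "(\<lambda>t. emeasure (\<kappa> t) (f t -` B \<inter> space m)) \<in> borel_measurable p"
      by (rule emeasure_measurable_subprob_algebra2[OF _ measurable_prob_algebraD[OF \<kappa>]])
    have "emeasure \<nu> (A \<times> B) = emeasure (distr \<nu> \<nu> F) (A \<times> B)"
      using inv by (simp add: invariant_def)
    also have "\<dots> = emeasure \<nu> (F -` (A \<times> B) \<inter> space \<nu>)"
      by (rule emeasure_distr[OF F AB])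
    also have "\<dots> = (\<integral>\<^sup>+\<omega>. emeasure (\<kappa> (\<omega> 0)) (Pair \<omega> -` (F -` (A \<times> B) \<inter> space \<nu>)) \<partial>P)"
      by (rule disint[OF measurable_sets[OF F AB]])
    also have "\<dots> = (\<integral>\<^sup>+\<omega>. emeasure (\<kappa> (\<omega> 0)) (f (\<omega> 0) -` B \<inter> space m) * indicator A (shift \<omega>) \<partial>P)"
    proof (rule nn_integral_cong)
      fix \<omega> assume "\<omega> \<in> space P"
      then have "Pair \<omega> -` (F -` (A \<times> B) \<inter> space \<nu>) =
          (if shift \<omega> \<in> A then f (\<omega> 0) -` B \<inter> space m else {})"
        by (auto simp: skew_product_def space)
      then show "emeasure (\<kappa> (\<omega> 0)) (Pair \<omega> -` (F -` (A \<times> B) \<inter> space \<nu>)) =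
          emeasure (\<kappa> (\<omega> 0)) (f (\<omega> 0) -` B \<inter> space m) * indicator A (shift \<omega>)"
        by (simp add: indicator_def)
    qed
    also have "\<dots> = c B * emeasure P A"
      unfolding c_def using A by (subst nn_integral_first_times_shift[OF meas]) auto
    finally show ?thesis .
  qed
  have "P \<Otimes>\<^sub>M distr \<nu> m snd = \<nu>"
  proof (rule pair_measure_eqI)
    show "sigma_finite_measure P" by (rule seq.P.sigma_finite_measure_axioms)
    show "sigma_finite_measure (distr \<nu> m snd)" by (rule mu.sigma_finite_measure_axioms)
    show "sets (P \<Otimes>\<^sub>M distr \<nu> m snd) = sets \<nu>" using sets_pair_eq sets by simp
    fix A B assume A: "A \<in> sets P" and "B \<in> sets (distr \<nu> m snd)"
    then have B: "B \<in> sets m" by simp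
    have "snd -` B \<inter> space \<nu> = space P \<times> B"
      using sets.sets_into_space[OF B] by (auto simp: space)
    then have "emeasure (distr \<nu> m snd) B = c B"
      using B rect[OF sets.top B] by (simp add: emeasure_distr seq.P.emeasure_space_1)
    then show "emeasure P A * emeasure (distr \<nu> m snd) B = emeasure \<nu> (A \<times> B)"
      by (simp add: rect[OF A B] mult.commute)
  qed
  then show ?thesis ..
qed

text \<open>Invariance tested on the cylinders \<open>space P \<times> A\<close> is the stationarity equation, since only the first
  coordinate of \<open>\<omega>\<close> enters.\<close>

lemma stationary_of_invariant_product:
  assumes "prob_space \<mu>" and s: "sets \<mu> = sets m" and inv: "invariant (P \<Otimes>\<^sub>M \<mu>) F"
  shows "stationary p f \<mu>"
  unfolding stationary_def
proof (intro conjI ballI)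
  interpret mu: prob_space \<mu> by fact
  have space: "space \<mu> = space m" using sets_eq_imp_space_eq[OF s] .
  fix A assume A: "A \<in> sets \<mu>"
  have F: "F \<in> P \<Otimes>\<^sub>M \<mu> \<rightarrow>\<^sub>M P \<Otimes>\<^sub>M \<mu>" using inv by (simp add: invariant_def)
  have pA: "space P \<times> A \<in> sets (P \<Otimes>\<^sub>M \<mu>)" using A by simp
  have Am: "A \<in> sets m" using A s by simp
  have "{z\<in>space (p \<Otimes>\<^sub>M m). f (fst z) (snd z) \<in> A} \<in> sets (p \<Otimes>\<^sub>M m)"
    using Am by measurable
  also have "{z\<in>space (p \<Otimes>\<^sub>M m). f (fst z) (snd z) \<in> A} = (SIGMA t:space p. f t -` A \<inter> space m)"
    by (auto simp: space_pair_measure)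
  also have "sets (p \<Otimes>\<^sub>M m) = sets (p \<Otimes>\<^sub>M \<mu>)"
    by (rule sets_pair_measure_cong[OF refl s[symmetric]])
  finally have "(\<lambda>t. emeasure \<mu> (Pair t -` (SIGMA t:space p. f t -` A \<inter> space m))) \<in> borel_measurable p"
    by (rule mu.measurable_emeasure_Pair)
  moreover have "emeasure \<mu> (Pair t -` (SIGMA t:space p. f t -` A \<inter> space m)) =
      emeasure \<mu> (f t -` A \<inter> space m)" if "t \<in> space p" for t
    using that by (intro arg_cong[where f = "emeasure \<mu>"]) auto
  ultimately have meas: "(\<lambda>t. emeasure \<mu> (f t -` A \<inter> space m)) \<in> borel_measurable p"
    by (simp cong: measurable_cong)
  have "emeasure \<mu> A = emeasure (P \<Otimes>\<^sub>M \<mu>) (space P \<times> A)"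
    using A by (simp add: mu.emeasure_pair_measure_Times seq.P.emeasure_space_1)
  also have "\<dots> = emeasure (distr (P \<Otimes>\<^sub>M \<mu>) (P \<Otimes>\<^sub>M \<mu>) F) (space P \<times> A)"
    using inv by (simp add: invariant_def)
  also have "\<dots> = emeasure (P \<Otimes>\<^sub>M \<mu>) (F -` (space P \<times> A) \<inter> space (P \<Otimes>\<^sub>M \<mu>))"
    by (rule emeasure_distr[OF F pA])
  also have "\<dots> = (\<integral>\<^sup>+\<omega>. emeasure \<mu> (Pair \<omega> -` (F -` (space P \<times> A) \<inter> space (P \<Otimes>\<^sub>M \<mu>))) \<partial>P)"
    by (rule mu.emeasure_pair_measure_alt[OF measurable_sets[OF F pA]])
  also have "\<dots> = (\<integral>\<^sup>+\<omega>. emeasure \<mu> (f (\<omega> 0) -` A \<inter> space m) \<partial>P)"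
  proof (rule nn_integral_cong)
    fix \<omega> assume w: "\<omega> \<in> space P"
    have "Pair \<omega> -` (F -` (space P \<times> A) \<inter> space (P \<Otimes>\<^sub>M \<mu>)) = f (\<omega> 0) -` A \<inter> space m"
      using w measurable_space[OF measurable_shift w]
      by (auto simp: skew_product_def space_pair_measure space)
    then show "emeasure \<mu> (Pair \<omega> -` (F -` (space P \<times> A) \<inter> space (P \<Otimes>\<^sub>M \<mu>))) =
        emeasure \<mu> (f (\<omega> 0) -` A \<inter> space m)" by simp
  qed
  also have "\<dots> = (\<integral>\<^sup>+t. emeasure \<mu> (f t -` A \<inter> space m) \<partial>p)"
    by (rule nn_integral_first_coordinate[OF meas])
  also have "\<dots> = (\<integral>\<^sup>+t. emeasure (distr \<mu> \<mu> (f t)) A \<partial>p)"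
  proof (rule nn_integral_cong)
    fix t assume "t \<in> space p"
    then have "f t \<in> m \<rightarrow>\<^sub>M m" by measurable
    then have "f t \<in> \<mu> \<rightarrow>\<^sub>M \<mu>" using s by (simp cong: measurable_cong_sets)
    then show "emeasure \<mu> (f t -` A \<inter> space m) = emeasure (distr \<mu> \<mu> (f t)) A"
      using A by (simp add: emeasure_distr space)
  qed
  finally show "emeasure \<mu> A = (\<integral>\<^sup>+t. emeasure (distr \<mu> \<mu> (f t)) A \<partial>p)" .
qed fact

lemma markovian_product:
  assumes "prob_space \<mu>" "sets \<mu> = sets m" "ergodic (P \<Otimes>\<^sub>M \<mu>) F"
  shows "markovian p m f (P \<Otimes>\<^sub>M \<mu>)"
  unfolding markovian_def
proof (intro conjI bexI[of _ "\<lambda>_. \<mu>"] ballI)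
  interpret mu: prob_space \<mu> by fact
  show "prob_space (P \<Otimes>\<^sub>M \<mu>)" "invariant (P \<Otimes>\<^sub>M \<mu>) F"
    using assms(3) by (simp_all add: ergodic_def)
  show "sets (P \<Otimes>\<^sub>M \<mu>) = sets (P \<Otimes>\<^sub>M m)" by (rule sets_pair_eq[OF assms(2)])
  show "distr (P \<Otimes>\<^sub>M \<mu>) P fst = P" by (rule mu.distr_pair_fst)
  show "(\<lambda>_. \<mu>) \<in> p \<rightarrow>\<^sub>M prob_algebra m"
    using assms(1,2) by (simp add: space_prob_algebra)
  show "emeasure (P \<Otimes>\<^sub>M \<mu>) A = (\<integral>\<^sup>+\<omega>. emeasure \<mu> (Pair \<omega> -` A) \<partial>P)"
    if "A \<in> sets (P \<Otimes>\<^sub>M \<mu>)" for A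
    by (rule mu.emeasure_pair_measure_alt[OF that])
qed

section \<open>Basins over the fibers and basins of the skew product\<close>

lemma integral_snd_product:
  fixes \<psi> :: "'x \<Rightarrow> real"
  assumes "prob_space \<mu>" "\<psi> \<in> borel_measurable \<mu>"
  shows "(\<integral>z. \<psi> (snd z) \<partial>(P \<Otimes>\<^sub>M \<mu>)) = (\<integral>y. \<psi> y \<partial>\<mu>)"
proof -
  have "sigma_finite_measure \<mu>"
    using assms(1) by (simp add: prob_space_imp_sigma_finite)
  then show ?thesis
    using integral_distr[of snd "P \<Otimes>\<^sub>M \<mu>" \<mu> \<psi>] assms(2) distr_pair_snd[OF prob_space_P, of \<mu>]
    by simp
qed

lemma basin_of_fiber_observable:
  fixes \<psi> :: "'x \<Rightarrow> real"
  assumes "prob_space \<mu>" "sets \<mu> = sets m" "\<psi> \<in> borel_measurable m"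
  shows "basin F (P \<Otimes>\<^sub>M \<mu>) (\<lambda>z. \<psi> (snd z)) = (SIGMA \<omega>:space P. fiber_basin f \<omega> \<mu> \<psi>)"
proof -
  have "\<psi> \<in> borel_measurable \<mu>" using assms(2,3) by (simp cong: measurable_cong_sets)
  with assms(1) show ?thesis
    by (auto simp: basin_def fiber_basin_def skew_product_funpow space_pair_measure integral_snd_product)
qed

text \<open>For observables of the form \<open>\<psi> \<circ> snd\<close>, the two formulations of "the basins have full measure"
  are related by Fubini: the sections of the basins of the skew product are the fiber basins.\<close>

lemma fiber_basins_full_iff:
  fixes \<psi> :: "'x \<Rightarrow> real"
  assumes "finite I" and mu: "\<And>i. i \<in> I \<Longrightarrow> prob_space (\<mu> i)" "\<And>i. i \<in> I \<Longrightarrow> sets (\<mu> i) = sets m"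
    and psi: "\<psi> \<in> borel_measurable m"
  shows "(AE \<omega> in P. emeasure m (\<Union>i\<in>I. fiber_basin f \<omega> (\<mu> i) \<psi>) = 1) \<longleftrightarrow>
    emeasure (P \<Otimes>\<^sub>M m) (\<Union>i\<in>I. basin F (P \<Otimes>\<^sub>M \<mu> i) (\<lambda>z. \<psi> (snd z))) = 1"
proof -
  let ?U = "\<Union>i\<in>I. basin F (P \<Otimes>\<^sub>M \<mu> i) (\<lambda>z. \<psi> (snd z))"
  let ?V = "\<lambda>\<omega>. \<Union>i\<in>I. fiber_basin f \<omega> (\<mu> i) \<psi>"
  interpret pair_prob_space P m
    by unfold_locales
  have psi': "(\<lambda>z. \<psi> (snd z)) \<in> borel_measurable (P \<Otimes>\<^sub>M m)" using psi by measurable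
  have U: "?U \<in> sets (P \<Otimes>\<^sub>M m)"
    using \<open>finite I\<close> by (intro sets.finite_UN sets_basin[OF measurable_F psi'] sets_pair_eq mu)
  have fiber_eq: "Pair \<omega> -` ?U = ?V \<omega>" if "\<omega> \<in> space P" for \<omega>
    using that by (auto simp: basin_of_fiber_observable mu psi)
  have V: "emeasure m (?V \<omega>) = 1 \<longleftrightarrow> (AE x in m. (\<omega>, x) \<in> ?U)" if w: "\<omega> \<in> space P" for \<omega>
  proof -
    have "?V \<omega> \<in> sets m" using sets_Pair1[OF U, of \<omega>] fiber_eq[OF w] by simp
    then have "emeasure m (?V \<omega>) = 1 \<longleftrightarrow> (AE x in m. x \<in> ?V \<omega>)"
      by (simp add: m.emeasure_eq_measure m.prob_eq_1)
    then show ?thesis unfolding fiber_eq[OF w, symmetric] by simp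
  qed
  have "(AE \<omega> in P. emeasure m (?V \<omega>) = 1) \<longleftrightarrow> (AE \<omega> in P. AE x in m. (\<omega>, x) \<in> ?U)"
    using V by (intro AE_cong) simp
  also have "\<dots> \<longleftrightarrow> (AE z in P \<Otimes>\<^sub>M m. z \<in> ?U)"
  proof -
    have "{z \<in> space (P \<Otimes>\<^sub>M m). (fst z, snd z) \<in> ?U} = ?U"
      using sets.sets_into_space[OF U] by auto
    then have "{z \<in> space (P \<Otimes>\<^sub>M m). (fst z, snd z) \<in> ?U} \<in> sets (P \<Otimes>\<^sub>M m)"
      using U by (simp only:)
    from AE_pair_iff[OF this] show ?thesis by (simp only: prod.collapse)
  qed
  also have "\<dots> \<longleftrightarrow> emeasure (P \<Otimes>\<^sub>M m) ?U = 1"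
    using U by (simp add: emeasure_eq_measure prob_eq_1)
  finally show ?thesis .
qed

lemma AE_in_basin_product:
  assumes "prob_space \<mu>" "sets \<mu> = sets m" "ergodic (P \<Otimes>\<^sub>M \<mu>) F"
    and "\<phi> \<in> borel_measurable (P \<Otimes>\<^sub>M m)" "bounded (\<phi> ` space (P \<Otimes>\<^sub>M m))"
  shows "AE z in P \<Otimes>\<^sub>M \<mu>. z \<in> basin F (P \<Otimes>\<^sub>M \<mu>) \<phi>"
proof (rule AE_in_basin[OF assms(3)])
  interpret prob_space "P \<Otimes>\<^sub>M \<mu>" using assms(3) by (simp add: ergodic_def)
  note s = sets_pair_eq[OF assms(2)]
  obtain B where "\<And>z. z \<in> space (P \<Otimes>\<^sub>M m) \<Longrightarrow> norm (\<phi> z) \<le> B"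
    using assms(5) by (auto simp: bounded_iff)
  then show "integrable (P \<Otimes>\<^sub>M \<mu>) \<phi>"
    using assms(4) s sets_eq_imp_space_eq[OF s]
    by (intro integrable_const_bound[of _ B]) (auto cong: measurable_cong_sets)
qed

text \<open>Choose \<open>A\<close> to which the two stationary measures give different mass. The basins of the two
  product measures for the indicator of \<open>A\<close> prescribe different limits, so they are disjoint, while
  each has full measure for its own measure. Above \<open>S \<inter> S'\<close> full measure carries over to
  \<open>P \<Otimes>\<^sub>M m\<close>: almost every point there lies in both basins.\<close>

lemma ergodic_supports_disjoint:
  assumes 1: "prob_space \<mu>" "sets \<mu> = sets m" "ergodic (P \<Otimes>\<^sub>M \<mu>) F" "support_mod m \<mu> S"
    and 2: "prob_space \<mu>'" "sets \<mu>' = sets m" "ergodic (P \<Otimes>\<^sub>M \<mu>') F" "support_mod m \<mu>' S'"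
    and "\<mu> \<noteq> \<mu>'"
  shows "emeasure m (S \<inter> S') = 0"
proof -
  interpret mu: prob_space \<mu> by fact
  interpret mu': prob_space \<mu>' by fact
  obtain A where A: "A \<in> sets m" and ne: "emeasure \<mu> A \<noteq> emeasure \<mu>' A"
    using \<open>\<mu> \<noteq> \<mu>'\<close> 1(2) 2(2) measure_eqI[of \<mu> \<mu>'] by auto
  define \<phi> :: "(nat \<Rightarrow> 't) \<times> 'x \<Rightarrow> real" where "\<phi> z = indicator A (snd z)" for z
  have phi: "\<phi> \<in> borel_measurable (P \<Otimes>\<^sub>M m)" unfolding \<phi>_def[abs_def] using A by measurable
  have bdd: "bounded (\<phi> ` space (P \<Otimes>\<^sub>M m))"
    by (rule boundedI[of _ 1]) (auto simp: \<phi>_def indicator_def)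
  have int: "(\<integral>z. \<phi> z \<partial>(P \<Otimes>\<^sub>M \<mu>)) = measure \<mu> A" "(\<integral>z. \<phi> z \<partial>(P \<Otimes>\<^sub>M \<mu>')) = measure \<mu>' A"
    unfolding \<phi>_def using A 1(1,2) 2(1,2) by (subst integral_snd_product; simp)+
  let ?B = "basin F (P \<Otimes>\<^sub>M \<mu>) \<phi>" and ?B' = "basin F (P \<Otimes>\<^sub>M \<mu>') \<phi>"
  have disj: "?B \<inter> ?B' = {}"
    using ne LIMSEQ_unique
    by (auto simp: basin_def int mu.emeasure_eq_measure mu'.emeasure_eq_measure)
  have B: "?B \<in> sets (P \<Otimes>\<^sub>M m)" by (rule sets_basin[OF measurable_F phi sets_pair_eq[OF 1(2)]])
  have S: "S \<in> sets m" "S' \<in> sets m" using 1(4) 2(4) by (auto simp: support_mod_def)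
  let ?D = "space P \<times> (S \<inter> S')"
  have D: "?D \<in> sets (P \<Otimes>\<^sub>M m)" using S by simp
  have "emeasure (P \<Otimes>\<^sub>M \<mu>) (?D - ?B) = 0"
    using AE_in_basin_product[OF 1(1-3) phi bdd]
    by (intro emeasure_eq_0_if_AE_not_in) (auto elim!: eventually_mono)
  then have 3: "emeasure (P \<Otimes>\<^sub>M m) (?D - ?B) = 0"
    using D B by (intro null_over_support[OF m.sigma_finite_measure_axioms mu.sigma_finite_measure_axioms 1(2,4)]) auto
  have "emeasure (P \<Otimes>\<^sub>M \<mu>') (?D \<inter> ?B) = 0"
    using AE_in_basin_product[OF 2(1-3) phi bdd] disj
    by (intro emeasure_eq_0_if_AE_not_in) (auto elim!: eventually_mono)
  then have 4: "emeasure (P \<Otimes>\<^sub>M m) (?D \<inter> ?B) = 0"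
    using D B by (intro null_over_support[OF m.sigma_finite_measure_axioms mu'.sigma_finite_measure_axioms 2(2,4)]) auto
  have "emeasure (P \<Otimes>\<^sub>M m) ?D = emeasure (P \<Otimes>\<^sub>M m) (?D \<inter> ?B) + emeasure (P \<Otimes>\<^sub>M m) (?D - ?B)"
    using D B by (subst plus_emeasure) (auto intro!: arg_cong[where f = "emeasure _"])
  with 3 4 have "emeasure (P \<Otimes>\<^sub>M m) ?D = 0" by simp
  then show ?thesis
    using S by (simp add: m.emeasure_pair_measure_Times seq.P.emeasure_space_1)
qed

text \<open>The passage from observables on \<open>X\<close> to observables on \<open>\<Omega> \<times> X\<close>, and the place where nonsingularity
  enters. Let \<open>S0\<close> be the union of the supports. By the ergodic theorem and \<open>null_over_support\<close>, the points
  above \<open>S0\<close> outside every basin of \<open>\<phi>\<close> form a \<open>P \<Otimes>\<^sub>M m\<close>-null set, and by nonsingularity almost no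
  orbit ever meets it. The hypothesis on the fibers, applied to the indicator of \<open>S0\<close>, whose integrals
  are all \<open>1\<close>, forces almost every orbit to visit \<open>S0\<close>. At such a visit the orbit is in a basin, and basins
  are closed under preimages.\<close>

lemma skew_basins_full:
  fixes \<mu> :: "'i \<Rightarrow> 'x measure"
  assumes nonsing: "nonsingular (P \<Otimes>\<^sub>M m) F"
    and "finite I"
    and mu: "\<And>i. i \<in> I \<Longrightarrow> prob_space (\<mu> i)" "\<And>i. i \<in> I \<Longrightarrow> sets (\<mu> i) = sets m"
      "\<And>i. i \<in> I \<Longrightarrow> ergodic (P \<Otimes>\<^sub>M \<mu> i) F" "\<And>i. i \<in> I \<Longrightarrow> support_mod m (\<mu> i) (S i)"
    and fiber: "\<And>\<psi> :: 'x \<Rightarrow> real. \<psi> \<in> borel_measurable m \<Longrightarrow> bounded (\<psi> ` space m) \<Longrightarrow>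
      AE \<omega> in P. emeasure m (\<Union>i\<in>I. fiber_basin f \<omega> (\<mu> i) \<psi>) = 1"
    and phi: "\<phi> \<in> borel_measurable (P \<Otimes>\<^sub>M m)" "bounded (\<phi> ` space (P \<Otimes>\<^sub>M m))"
  shows "emeasure (P \<Otimes>\<^sub>M m) (\<Union>i\<in>I. basin F (P \<Otimes>\<^sub>M \<mu> i) \<phi>) = 1"
proof -
  interpret pair_prob_space P m
    by unfold_locales
  define S0 where "S0 = (\<Union>i\<in>I. S i)"
  define \<psi> :: "'x \<Rightarrow> real" where "\<psi> = indicator S0"
  let ?B = "\<lambda>i. basin F (P \<Otimes>\<^sub>M \<mu> i) \<phi>"
  let ?U = "\<Union>i\<in>I. ?B i"
  have S: "S i \<in> sets m" if "i \<in> I" for i using mu(4)[OF that] by (simp add: support_mod_def)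
  then have S0: "S0 \<in> sets m" unfolding S0_def using \<open>finite I\<close> by auto
  then have psi: "\<psi> \<in> borel_measurable m" by (simp add: \<psi>_def)
  have psi': "(\<lambda>z. \<psi> (snd z)) \<in> borel_measurable (P \<Otimes>\<^sub>M m)" using psi by measurable
  have bdd: "bounded (\<psi> ` space m)"
    by (rule boundedI[of _ 1]) (auto simp: \<psi>_def indicator_def)
  have B: "?B i \<in> sets (P \<Otimes>\<^sub>M m)" if "i \<in> I" for i
    by (rule sets_basin[OF measurable_F phi(1) sets_pair_eq[OF mu(2)[OF that]]])
  then have U: "?U \<in> sets (P \<Otimes>\<^sub>M m)" using \<open>finite I\<close> by auto
  have int: "(\<integral>z. \<psi> (snd z) \<partial>(P \<Otimes>\<^sub>M \<mu> i)) = 1" if i: "i \<in> I" for i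
  proof -
    interpret mu: prob_space "\<mu> i" by (rule mu(1)[OF i])
    have S0': "S0 \<in> sets (\<mu> i)" using S0 mu(2)[OF i] by simp
    have "emeasure (\<mu> i) (space m - S i) = 0" using mu(4)[OF i] by (simp add: support_mod_def)
    then have "space m - S i \<in> null_sets (\<mu> i)" using S[OF i] mu(2)[OF i] by auto
    then have "AE x in \<mu> i. x \<notin> space m - S i" by (rule AE_not_in)
    with AE_space have "AE x in \<mu> i. x \<in> S0"
      by eventually_elim (use i sets_eq_imp_space_eq[OF mu(2)[OF i]] in \<open>auto simp: S0_def\<close>)
    then have "measure (\<mu> i) S0 = 1" using S0' by (simp add: mu.prob_eq_1)
    moreover have "\<psi> \<in> borel_measurable (\<mu> i)" using S0' by (simp add: \<psi>_def)
    ultimately show ?thesis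
      using integral_snd_product[OF mu(1)[OF i]] S0' by (simp add: \<psi>_def)
  qed
  have "emeasure (P \<Otimes>\<^sub>M m) (\<Union>i\<in>I. basin F (P \<Otimes>\<^sub>M \<mu> i) (\<lambda>z. \<psi> (snd z))) = 1"
    using fiber_basins_full_iff[OF \<open>finite I\<close> mu(1,2) psi] fiber[OF psi bdd] by simp
  then have "AE z in P \<Otimes>\<^sub>M m. z \<in> (\<Union>i\<in>I. basin F (P \<Otimes>\<^sub>M \<mu> i) (\<lambda>z. \<psi> (snd z)))"
    by (intro AE_prob_1) (simp add: measure_def)
  then have visit: "AE z in P \<Otimes>\<^sub>M m. \<exists>n. snd ((F ^^ n) z) \<in> S0"
  proof eventually_elim
    case (elim z)
    then obtain i where i: "i \<in> I" and
      "(\<lambda>n. (\<Sum>j<n. \<psi> (snd ((F ^^ j) z))) / real n) \<longlonglongrightarrow> (\<integral>z. \<psi> (snd z) \<partial>(P \<Otimes>\<^sub>M \<mu> i))"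
      by (auto simp: basin_def)
    then have lim: "(\<lambda>n. (\<Sum>j<n. \<psi> (snd ((F ^^ j) z))) / real n) \<longlonglongrightarrow> 1"
      using int[OF i] by simp
    show ?case
    proof (rule ccontr)
      assume "\<not> ?case"
      \<comment> \<open>An orbit that avoids \<open>S0\<close> has averages \<open>0\<close>, not tending to \<open>1\<close>.\<close>
      then have "(\<lambda>n. (\<Sum>j<n. \<psi> (snd ((F ^^ j) z))) / real n) = (\<lambda>n. 0)"
        by (simp add: \<psi>_def)
      with lim show False by (simp add: LIMSEQ_const_iff)
    qed
  qed
  have null: "space P \<times> S i - ?B i \<in> null_sets (P \<Otimes>\<^sub>M m)" if i: "i \<in> I" for i
  proof (rule null_setsI)
    have D: "space P \<times> S i \<in> sets (P \<Otimes>\<^sub>M m)" using S[OF i] by simp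
    show "space P \<times> S i - ?B i \<in> sets (P \<Otimes>\<^sub>M m)" using D B[OF i] by auto
    have "emeasure (P \<Otimes>\<^sub>M \<mu> i) (space P \<times> S i - ?B i) = 0"
      using AE_in_basin_product[OF mu(1-3)[OF i] phi]
      by (intro emeasure_eq_0_if_AE_not_in) (auto elim!: eventually_mono)
    then show "emeasure (P \<Otimes>\<^sub>M m) (space P \<times> S i - ?B i) = 0"
      using D B[OF i] mu(1)[OF i]
      by (intro null_over_support[OF m.sigma_finite_measure_axioms prob_space_imp_sigma_finite mu(2,4)[OF i]])
        auto
  qed
  have "(\<Union>i\<in>I. space P \<times> S i - ?B i) \<in> null_sets (P \<Otimes>\<^sub>M m)"
    using \<open>finite I\<close> null by (intro null_sets.finite_UN) auto
  moreover have "space P \<times> S0 - ?U \<in> sets (P \<Otimes>\<^sub>M m)" using S0 U by simp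
  moreover have "space P \<times> S0 - ?U \<subseteq> (\<Union>i\<in>I. space P \<times> S i - ?B i)" by (auto simp: S0_def)
  ultimately have N: "space P \<times> S0 - ?U \<in> null_sets (P \<Otimes>\<^sub>M m)" by (rule null_sets_subset)
  \<comment> \<open>Nonsingularity: almost no orbit meets the exceptional null set above \<open>S0\<close>.\<close>
  have "AE z in P \<Otimes>\<^sub>M m. \<forall>n. z \<notin> (F ^^ n) -` (space P \<times> S0 - ?U) \<inter> space (P \<Otimes>\<^sub>M m)"
    unfolding AE_all_countable by (intro allI AE_not_in null_sets_funpow[OF nonsing N])
  with visit AE_space have "AE z in P \<Otimes>\<^sub>M m. z \<in> ?U"
  proof eventually_elim
    case (elim z)
    then obtain n where n: "snd ((F ^^ n) z) \<in> S0" by blast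
    have sp: "(F ^^ k) z \<in> space (P \<Otimes>\<^sub>M m)" for k
      by (rule funpow_in_space[OF measurable_F elim(2)])
    then have "(F ^^ n) z \<in> ?U"
      using elim n sp[of n] by (auto simp: space_pair_measure mem_Times_iff)
    then obtain i where i: "i \<in> I" "(F ^^ n) z \<in> ?B i" by blast
    \<comment> \<open>Walk back along the orbit from time \<open>n\<close> to time \<open>0\<close>.\<close>
    have "(F ^^ (n - k)) z \<in> ?B i" if "k \<le> n" for k
      using that
    proof (induction k)
      case (Suc k)
      then have "F ((F ^^ (n - Suc k)) z) \<in> ?B i"
        by (metis Suc_diff_Suc Suc_leD Suc_le_lessD comp_apply funpow.simps(2))
      then show ?case
        by (rule basin_pullback) (use sp sets_eq_imp_space_eq[OF sets_pair_eq[OF mu(2)[OF i(1)]]] in auto)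
    qed (use i in simp)
    from this[of n] i(1) show ?case by auto
  qed
  then show ?thesis using U by (simp add: emeasure_eq_measure prob_eq_1)
qed

section \<open>The two implications\<close>

lemma FPM_imp_FPM_skew:
  assumes "nonsingular (P \<Otimes>\<^sub>M m) F" "FPM p m f"
  shows "FPM_skew p m f"
proof -
  obtain r :: nat and \<mu> :: "nat \<Rightarrow> 'x measure" and S where
    1: "\<forall>i\<in>{1..r}. sets (\<mu> i) = sets m \<and> ergodic_stationary p f (\<mu> i)" and
    2: "\<forall>i\<in>{1..r}. absolutely_continuous m (\<mu> i)" and
    3: "\<forall>i\<in>{1..r}. support_mod m (\<mu> i) (S i)" and
    4: "\<forall>\<psi> :: 'x \<Rightarrow> real. \<psi> \<in> borel_measurable m \<longrightarrow> bounded (\<psi> ` space m) \<longrightarrow>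
        (AE \<omega> in P. emeasure m (\<Union>i\<in>{1..r}. fiber_basin f \<omega> (\<mu> i) \<psi>) = 1)"
    using assms(2) unfolding FPM_def by (elim exE conjE) (rule that)
  note s = 1[rule_format, THEN conjunct1] and erg = 1[rule_format, THEN conjunct2]
    and ac = 2[rule_format] and S = 3[rule_format] and fiber = 4[rule_format]
  have prob: "prob_space (\<mu> i)" and ergF: "ergodic (P \<Otimes>\<^sub>M \<mu> i) F" if "i \<in> {1..r}" for i
    using erg[OF that] by (auto simp: ergodic_stationary_def stationary_def)
  show ?thesis
    unfolding FPM_skew_def
  proof (intro exI[of _ r] exI[of _ "\<lambda>i. P \<Otimes>\<^sub>M \<mu> i"] conjI ballI allI impI)
    fix i assume i: "i \<in> {1..r}"
    show "sets (P \<Otimes>\<^sub>M \<mu> i) = sets (P \<Otimes>\<^sub>M m)" by (rule sets_pair_eq[OF s[OF i]])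
    show "ergodic (P \<Otimes>\<^sub>M \<mu> i) F" by (rule ergF[OF i])
    show "markovian p m f (P \<Otimes>\<^sub>M \<mu> i)" by (rule markovian_product[OF prob s ergF]) fact+
    show "absolutely_continuous (P \<Otimes>\<^sub>M m) (P \<Otimes>\<^sub>M \<mu> i)"
      using s[OF i] ac[OF i] prob[OF i]
      by (intro absolutely_continuous_pair m.sigma_finite_measure_axioms prob_space_imp_sigma_finite)
  next
    fix \<phi> :: "(nat \<Rightarrow> 't) \<times> 'x \<Rightarrow> real"
    assume phi: "\<phi> \<in> borel_measurable (P \<Otimes>\<^sub>M m)" "bounded (\<phi> ` space (P \<Otimes>\<^sub>M m))"
    show "emeasure (P \<Otimes>\<^sub>M m) (\<Union>i\<in>{1..r}. basin F (P \<Otimes>\<^sub>M \<mu> i) \<phi>) = 1"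
      by (intro skew_basins_full[where S = S])
        (fact assms(1) finite_atLeastAtMost prob s ergF S fiber phi)+
  qed
qed

text \<open>The measures given by the skew product may repeat, whereas disjointness of supports needs distinct
  ones. Hence the marginals are first collected in a finite set and enumerated again; this does not
  change the union of the basins.\<close>

lemma FPM_skew_imp_FPM:
  assumes "FPM_skew p m f"
  shows "FPM p m f"
proof -
  obtain r :: nat and \<nu> :: "nat \<Rightarrow> ((nat \<Rightarrow> 't) \<times> 'x) measure" where
    1: "\<forall>i\<in>{1..r}. sets (\<nu> i) = sets (P \<Otimes>\<^sub>M m) \<and> ergodic (\<nu> i) F" and
    2: "\<forall>i\<in>{1..r}. markovian p m f (\<nu> i)" and
    3: "\<forall>i\<in>{1..r}. absolutely_continuous (P \<Otimes>\<^sub>M m) (\<nu> i)" and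
    4: "\<forall>\<phi> :: (nat \<Rightarrow> 't) \<times> 'x \<Rightarrow> real. \<phi> \<in> borel_measurable (P \<Otimes>\<^sub>M m) \<longrightarrow>
      bounded (\<phi> ` space (P \<Otimes>\<^sub>M m)) \<longrightarrow>
      emeasure (P \<Otimes>\<^sub>M m) (\<Union>i\<in>{1..r}. basin F (\<nu> i) \<phi>) = 1"
    using assms unfolding FPM_skew_def by (elim exE conjE) (rule that)
  note s = 1[rule_format, THEN conjunct1] and erg = 1[rule_format, THEN conjunct2]
    and mark = 2[rule_format] and ac = 3[rule_format] and basins = 4[rule_format]
  define \<mu> where "\<mu> i = distr (\<nu> i) m snd" for i
  have nu: "\<nu> i = P \<Otimes>\<^sub>M \<mu> i" if "i \<in> {1..r}" for i
    unfolding \<mu>_def by (rule markovian_imp_product[OF mark[OF that]])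
  let ?V = "\<mu> ` {1..r}"
  have V: "prob_space M \<and> sets M = sets m \<and> ergodic (P \<Otimes>\<^sub>M M) F \<and> absolutely_continuous m M"
    if M_in: "M \<in> ?V" for M
  proof -
    obtain i where i: "i \<in> {1..r}" and M: "M = \<mu> i" using M_in by blast
    have "snd \<in> \<nu> i \<rightarrow>\<^sub>M m" using s[OF i] by (simp cong: measurable_cong_sets)
    then have prob: "prob_space M"
      using erg[OF i] by (simp add: M \<mu>_def ergodic_def prob_space.prob_space_distr)
    interpret M: prob_space M by (rule prob)
    have sM: "sets M = sets m" by (simp add: M \<mu>_def)
    have "A \<in> null_sets M" if A: "A \<in> null_sets m" for A
    proof (rule null_setsI)
      show "A \<in> sets M" using A sM by auto
      have "space P \<times> A \<in> null_sets (P \<Otimes>\<^sub>M m)"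
        using A by (auto simp: null_sets_def m.emeasure_pair_measure_Times)
      then have "space P \<times> A \<in> null_sets (P \<Otimes>\<^sub>M M)"
        using ac[OF i] unfolding nu[OF i] M absolutely_continuous_def by blast
      then have "emeasure (P \<Otimes>\<^sub>M M) (space P \<times> A) = 0" by (rule null_setsD1)
      then show "emeasure M A = 0"
        using \<open>A \<in> sets M\<close> by (simp add: M.emeasure_pair_measure_Times seq.P.emeasure_space_1)
    qed
    then have "absolutely_continuous m M"
      unfolding absolutely_continuous_def by blast
    moreover have "ergodic (P \<Otimes>\<^sub>M M) F" using erg[OF i] unfolding nu[OF i] M .
    ultimately show ?thesis using prob sM by blast
  qed
  obtain h where h: "bij_betw h {1..card ?V} ?V"
    using ex_bij_betw_nat_finite_1[of ?V] by auto
  have hV: "h i \<in> ?V" if "i \<in> {1..card ?V}" for i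
    using h that by (auto simp: bij_betw_def)
  have "\<exists>S. support_mod m M S" if "M \<in> ?V" for M
    using V[OF that] by (intro support_mod_exists m.sigma_finite_measure_axioms) auto
  then obtain T where T: "\<And>M. M \<in> ?V \<Longrightarrow> support_mod m M (T M)" by metis
  show ?thesis
    unfolding FPM_def
  proof (intro exI[of _ "card ?V"] exI[of _ h] exI[of _ "\<lambda>i. T (h i)"] conjI ballI allI impI)
    fix i assume i: "i \<in> {1..card ?V}"
    note Vi = V[OF hV[OF i]]
    show "sets (h i) = sets m" "absolutely_continuous m (h i)" using Vi by auto
    have "stationary p f (h i)"
      using Vi by (intro stationary_of_invariant_product) (auto simp: ergodic_def)
    with Vi show "ergodic_stationary p f (h i)" by (simp add: ergodic_stationary_def)
    show "support_mod m (h i) (T (h i))" by (rule T[OF hV[OF i]])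
    fix j assume j: "j \<in> {1..card ?V}" and "i \<noteq> j"
    then have "h i \<noteq> h j" using inj_on_eq_iff[OF bij_betw_imp_inj_on[OF h] i j] by simp
    then show "emeasure m (T (h i) \<inter> T (h j)) = 0"
      using Vi V[OF hV[OF j]]
      by (intro ergodic_supports_disjoint[OF _ _ _ T[OF hV[OF i]] _ _ _ T[OF hV[OF j]]]) simp_all
  next
    fix \<psi> :: "'x \<Rightarrow> real"
    assume psi: "\<psi> \<in> borel_measurable m" and bdd: "bounded (\<psi> ` space m)"
    have "(\<lambda>z. \<psi> (snd z)) \<in> borel_measurable (P \<Otimes>\<^sub>M m)" using psi by measurable
    moreover have "bounded ((\<lambda>z. \<psi> (snd z)) ` space (P \<Otimes>\<^sub>M m))"
      by (rule bounded_subset[OF bdd]) (auto simp: space_pair_measure)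
    ultimately have "emeasure (P \<Otimes>\<^sub>M m) (\<Union>i\<in>{1..r}. basin F (\<nu> i) (\<lambda>z. \<psi> (snd z))) = 1"
      by (rule basins)
    also have "(\<Union>i\<in>{1..r}. basin F (\<nu> i) (\<lambda>z. \<psi> (snd z))) =
        (\<Union>i\<in>{1..r}. basin F (P \<Otimes>\<^sub>M \<mu> i) (\<lambda>z. \<psi> (snd z)))"
      by (intro SUP_cong refl) (simp only: nu)
    finally have full: "emeasure (P \<Otimes>\<^sub>M m) \<dots> = 1" .
    have mu: "prob_space (\<mu> i)" "sets (\<mu> i) = sets m" if "i \<in> {1..r}" for i
      using V[OF imageI[OF that]] by blast+
    \<comment> \<open>Fubini, for the original and possibly repeating family.\<close>
    have "AE \<omega> in P. emeasure m (\<Union>i\<in>{1..r}. fiber_basin f \<omega> (\<mu> i) \<psi>) = 1"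
      by (rule iffD2[OF fiber_basins_full_iff]) (fact finite_atLeastAtMost mu psi full)+
    moreover have "(\<Union>i\<in>{1..card ?V}. fiber_basin f \<omega> (h i) \<psi>) =
        (\<Union>i\<in>{1..r}. fiber_basin f \<omega> (\<mu> i) \<psi>)" for \<omega>
    proof -
      have "(\<Union>i\<in>{1..card ?V}. fiber_basin f \<omega> (h i) \<psi>) =
          (\<Union>M\<in>h ` {1..card ?V}. fiber_basin f \<omega> M \<psi>)" by blast
      also have "h ` {1..card ?V} = ?V" using h by (simp add: bij_betw_def)
      finally show ?thesis by blast
    qed
    ultimately show "AE \<omega> in P. emeasure m (\<Union>i\<in>{1..card ?V}. fiber_basin f \<omega> (h i) \<psi>) = 1"
      by simp
  qed
qed

end

theorem theorem1:
  fixes m :: "'x::polish_space measure"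
    and p :: "'t measure"
    and f :: "'t \<Rightarrow> 'x \<Rightarrow> 'x"
  assumes "prob_space m" and "sets m = sets borel"
    and "prob_space p"
    and "(\<lambda>(t, x). f t x) \<in> p \<Otimes>\<^sub>M m \<rightarrow>\<^sub>M m"
    and "nonsingular (seq_measure p \<Otimes>\<^sub>M m) (skew_product f)"
  shows "FPM p m f \<longleftrightarrow> FPM_skew p m f"
proof -
  interpret random_map p m f
    using assms by (simp add: random_map_def random_map_axioms_def)
  show ?thesis
    using FPM_imp_FPM_skew[OF assms(5)] FPM_skew_imp_FPM by blast
qed

end
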